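(* Let $K$ be a field of characteristic different from $2$, let $G$ be a group, let $n\geq 1$, and let $\Gamma: UT_n=\bigoplus_{g\in G}A_g$ be the elementary $G$-grading on $UT_n$ defined by an $(n-1)$-tuple $(g_1,\dots,g_{n-1})\in G^{n-1}$. Then the following assertions are equivalent. (1) The canonical involution $\circ$ on $UT_n$ is homogeneous with respect to $\Gamma$. (2) For all $i,j\in\{1,\dots,n-1\}$, $k\in\{1,\dots,n-i\}$ and $l\in\{1,\dots,n-j\}$: if $g_i g_{i+1}\cdots g_{i+k-1}=g_j g_{j+1}\cdots g_{j+l-1}$, then $g_{n-i-k+1}\cdots g_{n-i}=g_{n-j-l+1}\cdots g_{n-j}$ (products taken with indices increasing by one from left to right).
   Context: $UT_n$ is the associative $K$-algebra of $n\times n$ upper triangular matrices over $K$, with matrix units $E_{i,j}$ ($i\le j$). A $G$-grading $\Gamma$ on an algebra $A$ is a decomposition $A=\bigoplus_{g\in G}A_g$ into subspaces with $A_gA_h\subseteq A_{gh}$ for all $g,h\in G$; its support is $\mathrm{Supp}\,\Gamma=\{g\in G: A_g\neq\{0\}\}$; an element of $A_g$ is called homogeneous of degree $g$. The elementary $G$-grading on $UT_n$ defined by $(g_1,\dots,g_{n-1})\in G^{n-1}$ is the grading in which each matrix unit is homogeneous, $\deg E_{i,i}=e$ (the neutral element of $G$) and $\deg E_{i,i+k}=g_i g_{i+1}\cdots g_{i+k-1}$ for $1\le i\le n-1$, $1\le k\le n-i$; that is, $A_g$ is the span of the matrix units of degree $g$. The canonical involution (reflection involution) $\circ$ on $UT_n$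 is the linear map with $E_{i,j}^\circ=E_{n-j+1,n-i+1}$ for $1\le i\le j\le n$. A map $\varphi:A\to A$ is $\theta$-homogeneous, for a bijection $\theta:\mathrm{Supp}\,\Gamma\to\mathrm{Supp}\,\Gamma$, if $\varphi(A_g)=A_{\theta(g)}$ for every $g\in\mathrm{Supp}\,\Gamma$; it is homogeneous if it is $\theta$-homogeneous for some such bijection $\theta$. *)

theory Defs
  imports "Jordan_Normal_Form.VS_Connect"
begin

section \<open>Gradings on an algebra\<close>

text \<open>
  An algebra is given by a HOL-Algebra \<^typ>\<open>('k, 'a) module\<close> record, which carries a multiplication
  besides the module operations. The locale \<open>algebra\<close> of HOL-Algebra does not apply to
  matrices, because it requires the multiplication to be commutative.
\<close>

text \<open>
  The last conjunct says that \<open>A\<close> is the direct sum of the components: every element is a finite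
  sum of elements of the components in exactly one way.
\<close>

definition is_grading ::
    "('k, 'r) ring_scheme \<Rightarrow> ('k, 'a, 'm) module_scheme \<Rightarrow> ('g, 'n) monoid_scheme \<Rightarrow> ('g \<Rightarrow> 'a set) \<Rightarrow> bool"
  where "is_grading R A G \<Gamma> \<longleftrightarrow>
    (\<forall>h\<in>carrier G. submodule R (\<Gamma> h) A) \<and>
    (\<forall>h\<in>carrier G. \<forall>h'\<in>carrier G. \<forall>x\<in>\<Gamma> h. \<forall>y\<in>\<Gamma> h'. x \<otimes>\<^bsub>A\<^esub> y \<in> \<Gamma> (h \<otimes>\<^bsub>G\<^esub> h')) \<and>
    (\<forall>x\<in>carrier A. \<exists>!f. (\<forall>h\<in>carrier G. f h \<in> \<Gamma> h) \<and> (\<forall>h. h \<notin> carrier G \<longrightarrow> f h = \<zero>\<^bsub>A\<^esub>) \<and>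
        finite {h. f h \<noteq> \<zero>\<^bsub>A\<^esub>} \<and> x = finsum A f {h. f h \<noteq> \<zero>\<^bsub>A\<^esub>})"

definition Supp :: "('a, 'm) ring_scheme \<Rightarrow> ('g, 'n) monoid_scheme \<Rightarrow> ('g \<Rightarrow> 'a set) \<Rightarrow> 'g set"
  where "Supp A G \<Gamma> = {h \<in> carrier G. \<Gamma> h \<noteq> {\<zero>\<^bsub>A\<^esub>}}"

definition theta_homogeneous ::
    "('a, 'm) ring_scheme \<Rightarrow> ('g, 'n) monoid_scheme \<Rightarrow> ('g \<Rightarrow> 'a set) \<Rightarrow> ('g \<Rightarrow> 'g) \<Rightarrow> ('a \<Rightarrow> 'a) \<Rightarrow> bool"
  where "theta_homogeneous A G \<Gamma> \<theta> \<phi> \<longleftrightarrow> (\<forall>h\<in>Supp A G \<Gamma>. \<phi> ` \<Gamma> h = \<Gamma> (\<theta> h))"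

definition homogeneous_map ::
    "('a, 'm) ring_scheme \<Rightarrow> ('g, 'n) monoid_scheme \<Rightarrow> ('g \<Rightarrow> 'a set) \<Rightarrow> ('a \<Rightarrow> 'a) \<Rightarrow> bool"
  where "homogeneous_map A G \<Gamma> \<phi> \<longleftrightarrow>
    (\<exists>\<theta>. bij_betw \<theta> (Supp A G \<Gamma>) (Supp A G \<Gamma>) \<and> theta_homogeneous A G \<Gamma> \<theta> \<phi>)"


section \<open>Upper triangular matrices\<close>

definition UT :: "'a::field itself \<Rightarrow> nat \<Rightarrow> ('a, 'a mat) module"
  where "UT ty n = (module_mat ty n n)\<lparr>carrier := {X \<in> carrier_mat n n. upper_triangular X}\<rparr>"

lemma UT_simps [simp]:
  "carrier (UT TYPE('a::field) n) = {X \<in> carrier_mat n n. upper_triangular X}"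
  "mult (UT TYPE('a) n) = (*)"
  "zero (UT TYPE('a) n) = 0\<^sub>m n n"
  "add (UT TYPE('a) n) = (+)"
  "smult (UT TYPE('a) n) = (\<cdot>\<^sub>m)"
  by (simp_all add: UT_def module_mat_simps)

lemma module_UT: "module class_ring (UT TYPE('a::field) n)"
proof (rule moduleI)
  show "cring (class_ring :: 'a ring)" by unfold_locales
  show "abelian_group (UT TYPE('a) n)"
  proof (rule abelian_groupI)
    fix X assume "X \<in> carrier (UT TYPE('a) n)"
    then show "\<exists>Y\<in>carrier (UT TYPE('a) n). Y \<oplus>\<^bsub>UT TYPE('a) n\<^esub> X = \<zero>\<^bsub>UT TYPE('a) n\<^esub>"
      by (intro bexI[of _ "- X"]) (auto simp: upper_triangular_def)
  qed (auto simp: upper_triangular_def intro: comm_add_mat)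
qed (auto simp: upper_triangular_def intro!: eq_matI simp: algebra_simps)

lemma finsum_UT:
  assumes "finite S" and "\<And>s. s \<in> S \<Longrightarrow> f s \<in> carrier (UT TYPE('a::field) n)"
  shows "finsum (UT TYPE('a) n) f S \<in> carrier (UT TYPE('a) n)"
    and "r < n \<Longrightarrow> c < n \<Longrightarrow> finsum (UT TYPE('a) n) f S $$ (r, c) = (\<Sum>s\<in>S. f s $$ (r, c))"
proof -
  interpret U: Module.module class_ring "UT TYPE('a) n" by (rule module_UT)
  have *: "finsum (UT TYPE('a) n) f S \<in> carrier (UT TYPE('a) n) \<and>
    (r < n \<longrightarrow> c < n \<longrightarrow> finsum (UT TYPE('a) n) f S $$ (r, c) = (\<Sum>s\<in>S. f s $$ (r, c)))" for r c
    using assms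
  proof (induction S rule: finite_induct)
    case empty
    then show ?case by simp
  next
    case (insert x F)
    have "finsum (UT TYPE('a) n) f (insert x F) = f x + finsum (UT TYPE('a) n) f F"
      using insert by (subst U.finsum_insert) (auto simp del: UT_simps(1) simp: Pi_def)
    moreover have fx: "f x \<in> carrier (UT TYPE('a) n)" using insert.prems by blast
    moreover have F: "finsum (UT TYPE('a) n) f F \<in> carrier (UT TYPE('a) n)"
      and F_entry: "r < n \<Longrightarrow> c < n \<Longrightarrow>
        finsum (UT TYPE('a) n) f F $$ (r, c) = (\<Sum>s\<in>F. f s $$ (r, c))"
      using insert by blast+
    moreover have "f x + finsum (UT TYPE('a) n) f F \<in> carrier (UT TYPE('a) n)"
      using U.M.a_closed[OF fx F] by simp
    moreover have "(f x + finsum (UT TYPE('a) n) f F) $$ (r, c) = (\<Sum>s\<in>insert x F. f s $$ (r, c))"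
      if rc: "r < n" "c < n"
    proof -
      have "dim_row (finsum (UT TYPE('a) n) f F) = n" "dim_col (finsum (UT TYPE('a) n) f F) = n"
        using F by auto
      then show ?thesis using rc insert.hyps F_entry[OF rc] by simp
    qed
    ultimately show ?case by (simp del: UT_simps)
  qed
  show "finsum (UT TYPE('a) n) f S \<in> carrier (UT TYPE('a) n)"
    and "r < n \<Longrightarrow> c < n \<Longrightarrow> finsum (UT TYPE('a) n) f S $$ (r, c) = (\<Sum>s\<in>S. f s $$ (r, c))"
    using * by blast+
qed

text \<open>
  Matrix units are indexed from 1, whereas the entries of \<^typ>\<open>'a mat\<close> are indexed from 0.
\<close>

definition matrix_unit :: "nat \<Rightarrow> nat \<Rightarrow> nat \<Rightarrow> 'a::field mat"
  where "matrix_unit n i j = mat n n (\<lambda>(r, c). if r + 1 = i \<and> c + 1 = j then 1 else 0)"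

definition UT_indices :: "nat \<Rightarrow> (nat \<times> nat) set"
  where "UT_indices n = {(i, j). 1 \<le> i \<and> i \<le> j \<and> j \<le> n}"

text \<open>
  The linear extension of \<open>E\<^bsub>i,j\<^esub> \<mapsto> E\<^bsub>n-j+1,n-i+1\<^esub>\<close>. Only its values on \<open>UT\<^sub>n\<close> matter.
\<close>

definition canonical_involution :: "nat \<Rightarrow> 'a::field mat \<Rightarrow> 'a mat"
  where "canonical_involution n X = finsum (UT TYPE('a) n)
    (\<lambda>(i, j). X $$ (i - 1, j - 1) \<cdot>\<^sub>m matrix_unit n (n - j + 1) (n - i + 1)) (UT_indices n)"

lemma finite_UT_indices [simp]: "finite (UT_indices n)"
  by (rule finite_subset[of _ "{1..n} \<times> {1..n}"]) (auto simp: UT_indices_def)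

lemma smult_matrix_unit_in_UT:
  "(i, j) \<in> UT_indices n \<Longrightarrow> a \<cdot>\<^sub>m matrix_unit n i j \<in> carrier (UT TYPE('a::field) n)"
  by (auto simp: matrix_unit_def UT_indices_def upper_triangular_def)

lemma canonical_involution_index:
  assumes "r \<le> c" "c < n"
  shows "canonical_involution n X $$ (r, c) = (X :: 'a::field mat) $$ (n - 1 - c, n - 1 - r)"
proof -
  let ?f = "\<lambda>(i, j). X $$ (i - 1, j - 1) \<cdot>\<^sub>m matrix_unit n (n - j + 1) (n - i + 1)"
  have "?f s \<in> carrier (UT TYPE('a) n)" if "s \<in> UT_indices n" for s
  proof -
    obtain i j where s: "s = (i, j)" by force
    have "(n - j + 1, n - i + 1) \<in> UT_indices n" using that by (auto simp: s UT_indices_def)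
    from smult_matrix_unit_in_UT[OF this] show ?thesis by (simp add: s del: UT_simps(1))
  qed
  then have "canonical_involution n X $$ (r, c) = (\<Sum>s\<in>UT_indices n. ?f s $$ (r, c))"
    unfolding canonical_involution_def using assms by (intro finsum_UT(2)) auto
  also have "\<dots> = (\<Sum>s\<in>UT_indices n. if s = (n - c, n - r) then X $$ (n - 1 - c, n - 1 - r) else 0)"
    using assms by (intro sum.cong refl) (auto simp: matrix_unit_def UT_indices_def split: if_splits)
  also have "\<dots> = X $$ (n - 1 - c, n - 1 - r)"
    using assms by (subst sum.delta[OF finite_UT_indices]) (auto simp: UT_indices_def)
  finally show ?thesis .
qed

lemma canonical_involution_in_UT: "canonical_involution n X \<in> carrier (UT TYPE('a::field) n)"
  unfolding canonical_involution_def
proof (rule finsum_UT(1))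
  fix s assume "s \<in> UT_indices n"
  moreover obtain i j where s: "s = (i, j)" by force
  ultimately have "(n - j + 1, n - i + 1) \<in> UT_indices n" by (auto simp: UT_indices_def)
  from smult_matrix_unit_in_UT[OF this]
  show "(case s of (i, j) \<Rightarrow> X $$ (i - 1, j - 1) \<cdot>\<^sub>m matrix_unit n (n - j + 1) (n - i + 1))
      \<in> carrier (UT TYPE('a) n)"
    by (simp add: s del: UT_simps(1))
qed simp

lemma canonical_involution_matrix_unit:
  assumes "(i, j) \<in> UT_indices n"
  shows "canonical_involution n (matrix_unit n i j :: 'a::field mat) =
    matrix_unit n (n - j + 1) (n - i + 1)"
proof (rule eq_matI)
  fix r c assume "r < dim_row (matrix_unit n (n - j + 1) (n - i + 1) :: 'a mat)"
    "c < dim_col (matrix_unit n (n - j + 1) (n - i + 1) :: 'a mat)"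
  then have rc: "r < n" "c < n" by (auto simp: matrix_unit_def)
  show "canonical_involution n (matrix_unit n i j) $$ (r, c) =
    (matrix_unit n (n - j + 1) (n - i + 1) :: 'a mat) $$ (r, c)"
  proof (cases "r \<le> c")
    case True
    then show ?thesis
      using rc assms by (auto simp: canonical_involution_index matrix_unit_def UT_indices_def)
  next
    case False
    then show ?thesis
      using rc assms canonical_involution_in_UT[of n "matrix_unit n i j :: 'a mat"]
      by (auto simp: upper_triangular_def matrix_unit_def UT_indices_def)
  qed
qed (use canonical_involution_in_UT[of n "matrix_unit n i j :: 'a mat"] in
    \<open>auto simp: matrix_unit_def\<close>)


section \<open>Elementary gradings\<close>

text \<open>\<open>consec_prod G g a b\<close> is \<open>g\<^sub>a g\<^sub>a\<^sub>+\<^sub>1 \<dots> g\<^sub>b\<close>, in this order.\<close>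

definition consec_prod :: "('g, 'n) monoid_scheme \<Rightarrow> (nat \<Rightarrow> 'g) \<Rightarrow> nat \<Rightarrow> nat \<Rightarrow> 'g"
  where "consec_prod G g a b = foldr (\<lambda>x y. x \<otimes>\<^bsub>G\<^esub> y) (map g [a..<b + 1]) \<one>\<^bsub>G\<^esub>"

definition elementary_degree :: "('g, 'n) monoid_scheme \<Rightarrow> (nat \<Rightarrow> 'g) \<Rightarrow> nat \<Rightarrow> nat \<Rightarrow> 'g"
  where "elementary_degree G g i j = (if i = j then \<one>\<^bsub>G\<^esub> else consec_prod G g i (j - 1))"

definition elementary_grading ::
    "nat \<Rightarrow> ('g, 'n) monoid_scheme \<Rightarrow> (nat \<Rightarrow> 'g) \<Rightarrow> 'g \<Rightarrow> 'a::field mat set"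
  where "elementary_grading n G g h = LinearCombinations.module.span class_ring (UT TYPE('a) n)
    {matrix_unit n i j | i j. (i, j) \<in> UT_indices n \<and> elementary_degree G g i j = h}"

lemma elementary_grading_iff:
  "X \<in> elementary_grading n G g h \<longleftrightarrow> X \<in> carrier (UT TYPE('a::field) n) \<and>
    (\<forall>r c. r \<le> c \<longrightarrow> c < n \<longrightarrow> X $$ (r, c) \<noteq> 0 \<longrightarrow> elementary_degree G g (r + 1) (c + 1) = h)"
proof -
  interpret U: Module.module class_ring "UT TYPE('a) n" by (rule module_UT)
  let ?N = "{X \<in> carrier (UT TYPE('a) n). \<forall>r c. r \<le> c \<longrightarrow> c < n \<longrightarrow> X $$ (r, c) \<noteq> 0 \<longrightarrow>
    elementary_degree G g (r + 1) (c + 1) = h}"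
  let ?S = "{matrix_unit n i j :: 'a mat | i j.
    (i, j) \<in> UT_indices n \<and> elementary_degree G g i j = h}"
  have sub: "submodule class_ring ?N (UT TYPE('a) n)"
    unfolding LinearCombinations.submodule_def
  proof (intro conjI allI impI)
    fix X Y assume XY: "X \<in> ?N" "Y \<in> ?N"
    have "elementary_degree G g (r + 1) (c + 1) = h"
      if "r \<le> c" "c < n" "(X + Y) $$ (r, c) \<noteq> 0" for r c
      using XY that by (cases "X $$ (r, c) = 0"; cases "Y $$ (r, c) = 0") auto
    moreover have "X + Y \<in> carrier (UT TYPE('a) n)"
      using XY U.M.a_closed[of X Y] by simp
    ultimately show "X \<oplus>\<^bsub>UT TYPE('a) n\<^esub> Y \<in> ?N"
      unfolding UT_simps(4) by blast
  next
    fix a :: 'a and X assume "X \<in> ?N"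
    then show "a \<odot>\<^bsub>UT TYPE('a) n\<^esub> X \<in> ?N" by (auto simp: upper_triangular_def)
  qed (use module_UT in auto)
  have S_N: "?S \<subseteq> ?N"
    by (auto simp: matrix_unit_def UT_indices_def upper_triangular_def split: if_splits)
  have S_carrier: "?S \<subseteq> carrier (UT TYPE('a) n)" using S_N by blast
  interpret W: LinearCombinations.submodule class_ring "U.span ?S" "UT TYPE('a) n"
    using U.span_is_submodule[OF S_carrier] .
  have "X \<in> ?N" if "X \<in> elementary_grading n G g h"
    using that U.span_is_subset[OF S_N sub] unfolding elementary_grading_def by blast
  moreover have "X \<in> elementary_grading n G g h" if X: "X \<in> ?N"
  proof -
    let ?f = "\<lambda>(i, j). X $$ (i - 1, j - 1) \<cdot>\<^sub>m matrix_unit n i j"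
    have f_carrier: "?f s \<in> carrier (UT TYPE('a) n)" if "s \<in> UT_indices n" for s
      using that smult_matrix_unit_in_UT by (cases s) (auto simp del: UT_simps(1))
    have f_span: "?f s \<in> U.span ?S" if s: "s \<in> UT_indices n" for s
    proof -
      obtain i j where ij: "s = (i, j)" by force
      show ?thesis
      proof (cases "X $$ (i - 1, j - 1) = 0")
        case True
        then have "?f s = 0\<^sub>m n n" by (auto simp: ij matrix_unit_def intro!: eq_matI)
        then show ?thesis using W.zero_closed by simp
      next
        case False
        have bnd: "i - 1 \<le> j - 1" "j - 1 < n" "i - 1 + 1 = i" "j - 1 + 1 = j"
          using s by (auto simp: ij UT_indices_def)
        have "elementary_degree G g i j = h"
        proof -
          have "elementary_degree G g (i - 1 + 1) (j - 1 + 1) = h"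
            using X bnd(1,2) False by blast
          then show ?thesis unfolding bnd(3,4) .
        qed
        then have "matrix_unit n i j \<in> U.span ?S"
          using s U.in_own_span[OF S_carrier] by (auto simp: ij)
        from W.smult_closed[OF _ this] show ?thesis by (simp add: ij)
      qed
    qed
    have X_eq: "X = finsum (UT TYPE('a) n) ?f (UT_indices n)"
    proof (rule eq_matI)
      have F: "finsum (UT TYPE('a) n) ?f (UT_indices n) \<in> carrier (UT TYPE('a) n)"
        by (rule finsum_UT(1)[OF finite_UT_indices f_carrier])
      then show "dim_row X = dim_row (finsum (UT TYPE('a) n) ?f (UT_indices n))"
        "dim_col X = dim_col (finsum (UT TYPE('a) n) ?f (UT_indices n))"
        using X by auto
      fix r c assume "r < dim_row (finsum (UT TYPE('a) n) ?f (UT_indices n))"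
        "c < dim_col (finsum (UT TYPE('a) n) ?f (UT_indices n))"
      then have rc: "r < n" "c < n" using F by auto
      show "X $$ (r, c) = finsum (UT TYPE('a) n) ?f (UT_indices n) $$ (r, c)"
      proof (cases "r \<le> c")
        case True
        have "finsum (UT TYPE('a) n) ?f (UT_indices n) $$ (r, c) =
          (\<Sum>s\<in>UT_indices n. ?f s $$ (r, c))"
          by (rule finsum_UT(2)[OF finite_UT_indices f_carrier rc])
        also have "\<dots> = (\<Sum>s\<in>UT_indices n. if s = (r + 1, c + 1) then X $$ (r, c) else 0)"
          using rc by (intro sum.cong refl) (auto simp: matrix_unit_def split: if_splits)
        also have "\<dots> = X $$ (r, c)"
          using rc True by (subst sum.delta[OF finite_UT_indices]) (auto simp: UT_indices_def)
        finally show ?thesis by simp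
      next
        case False
        then show ?thesis using X F rc by (auto simp: upper_triangular_def)
      qed
    qed
    have "finsum (UT TYPE('a) n) ?f T \<in> U.span ?S"
      if "finite T" "T \<subseteq> UT_indices n" for T
      using that
    proof (induction T rule: finite_induct)
      case empty
      then show ?case using W.zero_closed by simp
    next
      case (insert x F)
      have "finsum (UT TYPE('a) n) ?f (insert x F) =
          ?f x \<oplus>\<^bsub>UT TYPE('a) n\<^esub> finsum (UT TYPE('a) n) ?f F"
      proof (rule U.finsum_insert)
        show "?f \<in> F \<rightarrow> carrier (UT TYPE('a) n)"
          using f_carrier insert.prems by blast
        show "?f x \<in> carrier (UT TYPE('a) n)"
          using insert.prems by (intro f_carrier) blast
      qed fact+
      then show ?case using insert f_span W.m_closed by auto
    qed
    from this[OF finite_UT_indices order_refl] show ?thesis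
      unfolding elementary_grading_def by (subst X_eq)
  qed
  ultimately show ?thesis by blast
qed

lemma consec_prod_closed:
  assumes "group G" and "\<And>i. a \<le> i \<Longrightarrow> i \<le> b \<Longrightarrow> g i \<in> carrier G"
  shows "consec_prod G g a b \<in> carrier G"
proof -
  interpret group G by fact
  have "foldr (\<lambda>x y. x \<otimes>\<^bsub>G\<^esub> y) xs \<one>\<^bsub>G\<^esub> \<in> carrier G" if "set xs \<subseteq> carrier G" for xs
    using that by (induction xs) auto
  moreover have "set (map g [a..<b + 1]) \<subseteq> carrier G"
    using assms(2) by (auto simp del: upt_Suc)
  ultimately show ?thesis unfolding consec_prod_def by blast
qed

lemma foldr_mult_append:
  assumes "group G" and "set xs \<subseteq> carrier G" and "set ys \<subseteq> carrier G"
  shows "foldr (\<lambda>x y. x \<otimes>\<^bsub>G\<^esub> y) (xs @ ys) \<one>\<^bsub>G\<^esub> =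
    foldr (\<lambda>x y. x \<otimes>\<^bsub>G\<^esub> y) xs \<one>\<^bsub>G\<^esub> \<otimes>\<^bsub>G\<^esub> foldr (\<lambda>x y. x \<otimes>\<^bsub>G\<^esub> y) ys \<one>\<^bsub>G\<^esub>"
proof -
  interpret group G by fact
  have closed: "foldr (\<lambda>x y. x \<otimes>\<^bsub>G\<^esub> y) zs \<one>\<^bsub>G\<^esub> \<in> carrier G" if "set zs \<subseteq> carrier G" for zs
    using that by (induction zs) auto
  show ?thesis
    using assms(2) closed[OF assms(3)] by (induction xs) (auto simp: m_assoc closed)
qed

lemma elementary_degree_eq:
  "1 \<le> i \<Longrightarrow> i \<le> j \<Longrightarrow>
    elementary_degree G g i j = foldr (\<lambda>x y. x \<otimes>\<^bsub>G\<^esub> y) (map g [i..<j]) \<one>\<^bsub>G\<^esub>"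
  by (simp add: elementary_degree_def consec_prod_def)

lemma elementary_degree_closed:
  assumes "group G" and "g \<in> {1..n - 1} \<rightarrow> carrier G" and "1 \<le> i" "i \<le> j" "j \<le> n"
  shows "elementary_degree G g i j \<in> carrier G"
proof -
  interpret group G by fact
  show ?thesis
    using assms unfolding elementary_degree_def by (auto intro!: consec_prod_closed)
qed

lemma elementary_degree_mult:
  assumes "group G" and "g \<in> {1..n - 1} \<rightarrow> carrier G"
    and "1 \<le> i" "i \<le> j" "j \<le> k" "k \<le> n"
  shows "elementary_degree G g i k = elementary_degree G g i j \<otimes>\<^bsub>G\<^esub> elementary_degree G g j k"
proof -
  have "[i..<k] = [i..<j] @ [j..<k]"
    using assms(4,5) upt_add_eq_append[of i j "k - j"] by simp
  moreover have "set (map g [i..<j]) \<subseteq> carrier G" "set (map g [j..<k]) \<subseteq> carrier G"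
    using assms by (auto simp: Pi_def)
  ultimately show ?thesis
    using assms foldr_mult_append[OF assms(1)] by (simp add: elementary_degree_eq)
qed

lemma is_grading_elementary_grading:
  fixes G :: "('g, 'm) monoid_scheme"
  assumes G: "group G" and g: "g \<in> {1..n - 1} \<rightarrow> carrier G"
  shows "is_grading class_ring (UT TYPE('a::field) n) G (elementary_grading n G g)"
  unfolding is_grading_def
proof (intro conjI ballI)
  interpret U: Module.module class_ring "UT TYPE('a) n" by (rule module_UT)
  let ?deg = "\<lambda>r c. elementary_degree G g (r + 1) (c + 1)"
  have deg_closed: "?deg r c \<in> carrier G" if "r \<le> c" "c < n" for r c
    using that by (intro elementary_degree_closed[OF G g]) auto

  show "submodule class_ring (elementary_grading n G g h) (UT TYPE('a) n)" for h
    unfolding elementary_grading_def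
    by (rule U.span_is_submodule)
      (auto simp: matrix_unit_def UT_indices_def upper_triangular_def)

  show "X \<otimes>\<^bsub>UT TYPE('a) n\<^esub> Y \<in> elementary_grading n G g (h \<otimes>\<^bsub>G\<^esub> h')"
    if X: "X \<in> elementary_grading n G g h" and Y: "Y \<in> elementary_grading n G g h'"
    for h h' and X Y :: "'a mat"
    unfolding elementary_grading_iff
  proof (intro conjI allI impI)
    have C: "X \<in> carrier_mat n n" "Y \<in> carrier_mat n n" "upper_triangular X" "upper_triangular Y"
      using X Y unfolding elementary_grading_iff by auto
    have entry: "(X * Y) $$ (r, c) = (\<Sum>k<n. X $$ (r, k) * Y $$ (k, c))" if "r < n" "c < n" for r c
      using C that by (simp add: scalar_prod_def atLeast0LessThan)
    have nz: "\<exists>k. r \<le> k \<and> k \<le> c \<and> X $$ (r, k) \<noteq> 0 \<and> Y $$ (k, c) \<noteq> 0"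
      if rc: "r < n" "c < n" "(X * Y) $$ (r, c) \<noteq> 0" for r c
    proof -
      obtain k where k: "k < n" "X $$ (r, k) * Y $$ (k, c) \<noteq> 0"
      proof (rule ccontr)
        assume "\<not> thesis"
        with that have "X $$ (r, k) * Y $$ (k, c) = 0" if "k < n" for k using that by blast
        then have "(\<Sum>k<n. X $$ (r, k) * Y $$ (k, c)) = 0" by (intro sum.neutral) blast
        then show False using rc entry[of r c] by metis
      qed
      then have "X $$ (r, k) \<noteq> 0" "Y $$ (k, c) \<noteq> 0" by auto
      then have "\<not> k < r" "\<not> c < k"
        using C rc k(1) upper_triangularD[of X k r] upper_triangularD[of Y c k] by auto
      then show ?thesis using k by (intro exI[of _ k]) auto
    qed
    show "X \<otimes>\<^bsub>UT TYPE('a) n\<^esub> Y \<in> carrier (UT TYPE('a) n)"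
    proof -
      have "upper_triangular (X * Y)"
      proof (rule upper_triangularI, rule ccontr)
        fix i j assume "j < i" "i < dim_row (X * Y)" "(X * Y) $$ (i, j) \<noteq> 0"
        with nz[of i j] C show False by auto
      qed
      then show ?thesis using C by simp
    qed
    fix r c assume rc: "r \<le> c" "c < n" "(X \<otimes>\<^bsub>UT TYPE('a) n\<^esub> Y) $$ (r, c) \<noteq> 0"
    then obtain k where k: "r \<le> k" "k \<le> c" "X $$ (r, k) \<noteq> 0" "Y $$ (k, c) \<noteq> 0"
      using nz[of r c] by auto
    have "?deg r k = h" "?deg k c = h'"
      using X Y k rc unfolding elementary_grading_iff by auto
    moreover have "?deg r c = ?deg r k \<otimes>\<^bsub>G\<^esub> ?deg k c"
      using k rc by (intro elementary_degree_mult[OF G g]) auto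
    ultimately show "?deg r c = h \<otimes>\<^bsub>G\<^esub> h'" by simp
  qed

  fix X assume X: "X \<in> carrier (UT TYPE('a) n)"
  let ?P = "\<lambda>f. (\<forall>h\<in>carrier G. f h \<in> elementary_grading n G g h) \<and>
    (\<forall>h. h \<notin> carrier G \<longrightarrow> f h = \<zero>\<^bsub>UT TYPE('a) n\<^esub>) \<and>
    finite {h. f h \<noteq> \<zero>\<^bsub>UT TYPE('a) n\<^esub>} \<and>
    X = finsum (UT TYPE('a) n) f {h. f h \<noteq> \<zero>\<^bsub>UT TYPE('a) n\<^esub>}"
  let ?F = "\<lambda>h. mat n n (\<lambda>(r, c). if r \<le> c \<and> ?deg r c = h then X $$ (r, c) else 0)"
  have F_carrier: "?F h \<in> carrier (UT TYPE('a) n)" for h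
    by (auto simp: upper_triangular_def)
  let ?D = "(\<lambda>(r, c). ?deg r c) ` ({..<n} \<times> {..<n})"
  have supp: "{h. ?F h \<noteq> \<zero>\<^bsub>UT TYPE('a) n\<^esub>} \<subseteq> ?D \<inter> carrier G"
  proof
    fix h assume "h \<in> {h. ?F h \<noteq> \<zero>\<^bsub>UT TYPE('a) n\<^esub>}"
    then have "?F h \<noteq> 0\<^sub>m n n" by simp
    then obtain r c where "r < n" "c < n" "r \<le> c" "?deg r c = h"
    proof -
      have "\<exists>r c. r < n \<and> c < n \<and> r \<le> c \<and> ?deg r c = h"
      proof (rule ccontr)
        assume "\<not> ?thesis"
        then have "?F h = 0\<^sub>m n n" by (intro eq_matI) auto
        with \<open>?F h \<noteq> 0\<^sub>m n n\<close> show False ..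
      qed
      then show thesis using that by blast
    qed
    then show "h \<in> ?D \<inter> carrier G" using deg_closed[of r c] by auto
  qed
  have fin: "finite {h. ?F h \<noteq> \<zero>\<^bsub>UT TYPE('a) n\<^esub>}"
    by (rule finite_subset[OF supp]) auto
  have sum_supp: "(\<Sum>h\<in>{h. f h \<noteq> \<zero>\<^bsub>UT TYPE('a) n\<^esub>}. f h $$ (r, c)) = f (?deg r c) $$ (r, c)"
    if f: "\<And>h. h \<in> carrier G \<Longrightarrow> f h \<in> elementary_grading n G g h"
      "\<And>h. h \<notin> carrier G \<Longrightarrow> f h = \<zero>\<^bsub>UT TYPE('a) n\<^esub>"
      "finite {h. f h \<noteq> \<zero>\<^bsub>UT TYPE('a) n\<^esub>}" and rc: "r \<le> c" "c < n" for f :: "'g \<Rightarrow> 'a mat" and r c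
  proof -
    have "f h $$ (r, c) = 0" if "h \<noteq> ?deg r c" for h
      using f(1,2)[of h] that rc unfolding elementary_grading_iff by (cases "h \<in> carrier G") auto
    then have "(\<Sum>h\<in>{h. f h \<noteq> \<zero>\<^bsub>UT TYPE('a) n\<^esub>}. f h $$ (r, c)) =
      (\<Sum>h\<in>{h. f h \<noteq> \<zero>\<^bsub>UT TYPE('a) n\<^esub>}. if h = ?deg r c then f (?deg r c) $$ (r, c) else 0)"
      by (intro sum.cong) auto
    also have "\<dots> = f (?deg r c) $$ (r, c)"
      using f(3) rc by (subst sum.delta) auto
    finally show ?thesis .
  qed
  have F_grading: "?F h \<in> elementary_grading n G g h" for h
    unfolding elementary_grading_iff using F_carrier by (auto split: if_splits)
  have F_zero: "?F h = \<zero>\<^bsub>UT TYPE('a) n\<^esub>" if "h \<notin> carrier G" for h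
    using supp that by blast
  show "\<exists>!f. ?P f"
  proof (rule ex1I[of _ ?F])
    have "X = finsum (UT TYPE('a) n) ?F {h. ?F h \<noteq> \<zero>\<^bsub>UT TYPE('a) n\<^esub>}" (is "X = ?S")
    proof (rule eq_matI)
      have S: "?S \<in> carrier (UT TYPE('a) n)" by (rule finsum_UT(1)[OF fin F_carrier])
      then show "dim_row X = dim_row ?S" "dim_col X = dim_col ?S" using X by auto
      fix r c assume "r < dim_row ?S" "c < dim_col ?S"
      then have rc: "r < n" "c < n" using S by auto
      show "X $$ (r, c) = ?S $$ (r, c)"
      proof (cases "r \<le> c")
        case True
        have "?S $$ (r, c) = (\<Sum>h\<in>{h. ?F h \<noteq> \<zero>\<^bsub>UT TYPE('a) n\<^esub>}. ?F h $$ (r, c))"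
          by (rule finsum_UT(2)[OF fin F_carrier rc])
        also have "\<dots> = ?F (?deg r c) $$ (r, c)"
          by (rule sum_supp[OF F_grading F_zero fin True rc(2)])
        finally show ?thesis using rc True by simp
      next
        case False
        then show ?thesis using X S rc by (auto simp: upper_triangular_def)
      qed
    qed
    then show "?P ?F" using F_grading F_zero fin by blast
  next
    fix f assume f: "?P f"
    have f_carrier: "f h \<in> carrier (UT TYPE('a) n)" for h
      using f by (cases "h \<in> carrier G") (auto simp: elementary_grading_iff)
    have entry: "X $$ (r, c) = f (?deg r c) $$ (r, c)" if "r \<le> c" "c < n" for r c
    proof -
      have "X $$ (r, c) = (\<Sum>h\<in>{h. f h \<noteq> \<zero>\<^bsub>UT TYPE('a) n\<^esub>}. f h $$ (r, c))"
        using f finsum_UT(2)[of "{h. f h \<noteq> \<zero>\<^bsub>UT TYPE('a) n\<^esub>}" f n r c] f_carrier that by auto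
      also have "\<dots> = f (?deg r c) $$ (r, c)"
        using f that by (intro sum_supp) auto
      finally show ?thesis .
    qed
    show "f = ?F"
    proof
      fix h
      show "f h = ?F h"
      proof (rule eq_matI)
        fix r c assume "r < dim_row (?F h)" "c < dim_col (?F h)"
        then have rc: "r < n" "c < n" by auto
        show "f h $$ (r, c) = ?F h $$ (r, c)"
        proof (cases "r \<le> c \<and> ?deg r c = h")
          case True
          then show ?thesis using entry[of r c] rc by auto
        next
          case False
          then have "f h $$ (r, c) = 0"
          proof (cases "r \<le> c")
            case le: True
            then have "f h \<in> elementary_grading n G g h \<or> f h = 0\<^sub>m n n"
              using f by (cases "h \<in> carrier G") auto
            then show ?thesis
              using False le rc unfolding elementary_grading_iff by auto
          next
            case False
            then show ?thesis using f_carrier[of h] rc by (auto simp: upper_triangular_def)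
          qed
          then show ?thesis using False rc by auto
        qed
      qed (use f_carrier[of h] in auto)
    qed
  qed
qed

end

theory Submission
  imports Defs
begin

text \<open>
  The involution permutes the matrix units, so it is homogeneous iff the degree of a unit determines
  the degree of the reflected unit. Condition (2) says this for off-diagonal units only. It also
  forces an off-diagonal unit \<open>E\<^bsub>i,m\<^esub>\<close> of degree \<open>e\<close> to have a reflection of degree \<open>e\<close>: for
  \<open>m < n\<close> the units \<open>E\<^bsub>i,n\<^esub>\<close> and \<open>E\<^bsub>m,n\<^esub>\<close> have equal degrees, and equality of the degrees of their
  reflections, which both lie in the first row, cancels to the claim; the case \<open>i > 1\<close> is
  symmetric, and \<open>E\<^bsub>1,n\<^esub>\<close> is its own reflection.
\<close>

section \<open>Reflection of matrix units\<close>

text \<open>The permutation of index pairs by which the involution acts on the matrix units: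
  reflection across the antidiagonal.\<close>

definition reflect :: "nat \<Rightarrow> nat \<times> nat \<Rightarrow> nat \<times> nat"
  where "reflect n = (\<lambda>(i, j). (n - j + 1, n - i + 1))"

lemma reflect_in_UT_indices: "s \<in> UT_indices n \<Longrightarrow> reflect n s \<in> UT_indices n"
  by (auto simp: reflect_def UT_indices_def)

lemma reflect_reflect: "s \<in> UT_indices n \<Longrightarrow> reflect n (reflect n s) = s"
  by (auto simp: reflect_def UT_indices_def)

text \<open>On and above the diagonal the involution reads the entry at the reflected position, and
  reflecting twice restores it; below the diagonal both matrices vanish. This later turns one
  inclusion between components into equality.\<close>

lemma canonical_involution_involutive:
  assumes "X \<in> carrier (UT TYPE('a::field) n)"
  shows "canonical_involution n (canonical_involution n X) = X"
proof (rule eq_matI)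
  let ?Y = "canonical_involution n (canonical_involution n X)"
  have Y: "?Y \<in> carrier (UT TYPE('a) n)" by (rule canonical_involution_in_UT)
  show "dim_row ?Y = dim_row X" "dim_col ?Y = dim_col X" using assms Y by auto
  fix r c assume "r < dim_row X" "c < dim_col X"
  then have rc: "r < n" "c < n" using assms by auto
  show "?Y $$ (r, c) = X $$ (r, c)"
  proof (cases "r \<le> c")
    case True
    then show ?thesis using rc by (simp add: canonical_involution_index)
  next
    case False
    then show ?thesis using assms Y rc by (auto simp: upper_triangular_def)
  qed
qed

section \<open>Degrees of matrix units and the support\<close>

text \<open>A unit has a single nonzero entry, so the entrywise criterion for membership in a
  component tests one position only.\<close>

lemma matrix_unit_in_elementary_grading_iff:
  assumes "(i, j) \<in> UT_indices n"
  shows "(matrix_unit n i j :: 'a::field mat) \<in> elementary_grading n G g h \<longleftrightarrow>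
    elementary_degree G g i j = h"
proof -
  have "(matrix_unit n i j :: 'a mat) \<in> carrier (UT TYPE('a) n)"
    using assms by (auto simp: matrix_unit_def UT_indices_def upper_triangular_def)
  moreover have "(\<forall>r c. r \<le> c \<longrightarrow> c < n \<longrightarrow> (matrix_unit n i j :: 'a mat) $$ (r, c) \<noteq> 0 \<longrightarrow>
      elementary_degree G g (r + 1) (c + 1) = h) \<longleftrightarrow> elementary_degree G g i j = h" (is "?L \<longleftrightarrow> ?R")
  proof
    assume ?L
    \<comment> \<open>The nonzero entry has zero-based position \<open>(i - 1, j - 1)\<close>;
      truncated subtraction is harmless since \<open>i\<close> and \<open>j\<close> are at least
      1.\<close>
    moreover have "i - 1 \<le> j - 1" "j - 1 < n" "i - 1 + 1 = i" "j - 1 + 1 = j"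
      using assms by (auto simp: UT_indices_def)
    moreover have "(matrix_unit n i j :: 'a mat) $$ (i - 1, j - 1) \<noteq> 0"
      using assms by (auto simp: matrix_unit_def UT_indices_def)
    ultimately show ?R by metis
  qed (auto simp: matrix_unit_def split: if_splits)
  ultimately show ?thesis unfolding elementary_grading_iff by blast
qed

lemma Supp_elementary_grading:
  assumes G: "group G" and g: "g \<in> {1..n - 1} \<rightarrow> carrier G"
  shows "Supp (UT TYPE('a::field) n) G (elementary_grading n G g) =
    case_prod (elementary_degree G g) ` UT_indices n"
proof (intro subset_antisym subsetI)
  fix h assume "h \<in> Supp (UT TYPE('a) n) G (elementary_grading n G g)"
  then have "(elementary_grading n G g h :: 'a mat set) \<noteq> {0\<^sub>m n n}" by (simp add: Supp_def)
  moreover have "(0\<^sub>m n n :: 'a mat) \<in> elementary_grading n G g h"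
    by (auto simp: elementary_grading_iff upper_triangular_def)
  ultimately obtain X :: "'a mat" where X: "X \<in> elementary_grading n G g h" "X \<noteq> 0\<^sub>m n n"
    by blast
  from X(1) have XU: "X \<in> carrier (UT TYPE('a) n)" unfolding elementary_grading_iff by blast
  obtain r c where rc: "r < n" "c < n" "X $$ (r, c) \<noteq> 0"
  proof (rule ccontr)
    assume "\<not> thesis"
    with that have "X = 0\<^sub>m n n" using XU by (intro eq_matI) auto
    with X(2) show False ..
  qed
  \<comment> \<open>The entrywise criterion speaks only of positions on or above the
    diagonal.\<close>
  have "r \<le> c"
    using XU rc by (metis UT_simps(1) carrier_matD(1) mem_Collect_eq not_le upper_triangularD)
  then have "elementary_degree G g (r + 1) (c + 1) = h" "(r + 1, c + 1) \<in> UT_indices n"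
    using X(1) rc unfolding elementary_grading_iff by (auto simp: UT_indices_def)
  then show "h \<in> case_prod (elementary_degree G g) ` UT_indices n" by force
next
  fix h assume "h \<in> case_prod (elementary_degree G g) ` UT_indices n"
  then obtain i j where ij: "(i, j) \<in> UT_indices n" "h = elementary_degree G g i j" by auto
  then have "h \<in> carrier G"
    using elementary_degree_closed[OF G g] by (auto simp: UT_indices_def)
  moreover have "(matrix_unit n i j :: 'a mat) \<in> elementary_grading n G g h"
    using ij by (simp add: matrix_unit_in_elementary_grading_iff)
  moreover have "(matrix_unit n i j :: 'a mat) \<noteq> 0\<^sub>m n n"
  proof
    assume "(matrix_unit n i j :: 'a mat) = 0\<^sub>m n n"
    then have "(matrix_unit n i j :: 'a mat) $$ (i - 1, j - 1) = 0\<^sub>m n n $$ (i - 1, j - 1)"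
      by simp
    then show False using ij(1) by (auto simp: matrix_unit_def UT_indices_def)
  qed
  ultimately show "h \<in> Supp (UT TYPE('a) n) G (elementary_grading n G g)"
    unfolding Supp_def UT_simps by blast
qed

section \<open>Homogeneity as a condition on degrees\<close>

text \<open>A nonzero entry of the image comes from a nonzero entry of \<open>X\<close> at the
  reflected position, so it is enough to control degrees unit by unit. If no unit has degree
  \<open>h\<close>, the hypothesis is vacuous.\<close>

lemma canonical_involution_image_subset:
  assumes "\<And>s. s \<in> UT_indices n \<Longrightarrow> case_prod (elementary_degree G g) s = h \<Longrightarrow>
    case_prod (elementary_degree G g) (reflect n s) = h'"
  shows "canonical_involution n ` elementary_grading n G g h \<subseteq>
    (elementary_grading n G g h' :: 'a::field mat set)"
proof (rule image_subsetI)
  fix X :: "'a mat" assume X: "X \<in> elementary_grading n G g h"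
  have "elementary_degree G g (r + 1) (c + 1) = h'"
    if rc: "r \<le> c" "c < n" "canonical_involution n X $$ (r, c) \<noteq> 0" for r c
  proof -
    have "X $$ (n - 1 - c, n - 1 - r) \<noteq> 0"
      using rc by (simp add: canonical_involution_index)
    then have "elementary_degree G g (n - 1 - c + 1) (n - 1 - r + 1) = h"
      using X rc unfolding elementary_grading_iff by auto
    moreover have "(n - 1 - c + 1, n - 1 - r + 1) \<in> UT_indices n"
      "reflect n (n - 1 - c + 1, n - 1 - r + 1) = (r + 1, c + 1)"
      using rc by (auto simp: UT_indices_def reflect_def)
    ultimately show ?thesis using assms[of "(n - 1 - c + 1, n - 1 - r + 1)"] by simp
  qed
  then show "canonical_involution n X \<in> elementary_grading n G g h'"
    unfolding elementary_grading_iff using canonical_involution_in_UT by blast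
qed

text \<open>The only candidate for \<theta> sends \<open>d s\<close> to
  \<open>d (reflect n s)\<close>, and the right-hand side says that this is well defined.
  Bijectivity is then automatic because \<open>reflect n\<close> is an involution on the index
  pairs.\<close>

lemma homogeneous_canonical_involution_iff:
  assumes G: "group G" and g: "g \<in> {1..n - 1} \<rightarrow> carrier G"
  defines "d \<equiv> case_prod (elementary_degree G g)"
  shows "homogeneous_map (UT TYPE('a::field) n) G (elementary_grading n G g)
      (canonical_involution n) \<longleftrightarrow>
    (\<forall>s\<in>UT_indices n. \<forall>t\<in>UT_indices n. d s = d t \<longrightarrow> d (reflect n s) = d (reflect n t))"
    (is "?L \<longleftrightarrow> ?R")
proof
  note Supp_eq = Supp_elementary_grading[OF G g, where 'a = 'a, folded d_def]
  assume ?L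
  then obtain \<theta> where \<theta>: "\<And>h. h \<in> d ` UT_indices n \<Longrightarrow>
      canonical_involution n ` elementary_grading n G g h =
      (elementary_grading n G g (\<theta> h) :: 'a mat set)"
    unfolding homogeneous_map_def theta_homogeneous_def Supp_eq by blast
  \<comment> \<open>Testing homogeneity on a single unit fixes \<theta> at its degree.\<close>
  have "d (reflect n s) = \<theta> (d s)" if s: "s \<in> UT_indices n" for s
  proof -
    obtain i j where ij: "s = (i, j)" by force
    have "(matrix_unit n i j :: 'a mat) \<in> elementary_grading n G g (d s)"
      using s by (simp add: ij d_def matrix_unit_in_elementary_grading_iff)
    then have "canonical_involution n (matrix_unit n i j :: 'a mat) \<in>
        elementary_grading n G g (\<theta> (d s))"
      using \<theta>[of "d s"] s by blast
    then show ?thesis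
      using s reflect_in_UT_indices[OF s]
      by (simp add: ij d_def canonical_involution_matrix_unit reflect_def
          matrix_unit_in_elementary_grading_iff)
  qed
  then show ?R by simp
next
  note Supp_eq = Supp_elementary_grading[OF G g, where 'a = 'a, folded d_def]
  assume R: ?R
  \<comment> \<open>The value is read off an arbitrary unit of degree \<open>h\<close>; by
    \<open>R\<close> the choice does not matter.\<close>
  define \<theta> where "\<theta> h = d (reflect n (SOME s. s \<in> UT_indices n \<and> d s = h))" for h
  have \<theta>_d: "\<theta> (d s) = d (reflect n s)" if "s \<in> UT_indices n" for s
    using someI[of "\<lambda>t. t \<in> UT_indices n \<and> d t = d s" s] R that unfolding \<theta>_def by metis
  have \<theta>_closed: "\<theta> h \<in> d ` UT_indices n" if "h \<in> d ` UT_indices n" for h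
    using that reflect_in_UT_indices by (auto simp: \<theta>_d)
  have \<theta>_\<theta>: "\<theta> (\<theta> h) = h" if "h \<in> d ` UT_indices n" for h
    using that by (auto simp: \<theta>_d reflect_in_UT_indices reflect_reflect)
  have "bij_betw \<theta> (d ` UT_indices n) (d ` UT_indices n)"
    using \<theta>_closed \<theta>_\<theta> by (intro bij_betw_byWitness[where f' = \<theta>]) auto
  moreover have "canonical_involution n ` elementary_grading n G g h =
      (elementary_grading n G g (\<theta> h) :: 'a mat set)" if h: "h \<in> d ` UT_indices n" for h
  proof
    have sub: "canonical_involution n ` elementary_grading n G g h \<subseteq>
        (elementary_grading n G g (\<theta> h) :: 'a mat set)" for h
      using \<theta>_d by (intro canonical_involution_image_subset) (metis d_def)
    then show "canonical_involution n ` elementary_grading n G g h \<subseteq>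
        (elementary_grading n G g (\<theta> h) :: 'a mat set)" .
    show "(elementary_grading n G g (\<theta> h) :: 'a mat set) \<subseteq>
        canonical_involution n ` elementary_grading n G g h"
    proof
      \<comment> \<open>The preimage is the reflection of \<open>X\<close>: \<open>sub\<close> at
        \<open>\<theta> h\<close> places it in the component of
        \<open>\<theta> (\<theta> h)\<close>, which is that of \<open>h\<close>.\<close>
      fix X :: "'a mat" assume X: "X \<in> elementary_grading n G g (\<theta> h)"
      then have "X = canonical_involution n (canonical_involution n X)"
        unfolding elementary_grading_iff by (simp only: canonical_involution_involutive)
      moreover have "canonical_involution n X \<in> elementary_grading n G g h"
        using X sub[of "\<theta> h"] \<theta>_\<theta>[OF h] by auto
      ultimately show "X \<in> canonical_involution n ` elementary_grading n G g h" by blast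
    qed
  qed
  ultimately show ?L
    unfolding homogeneous_map_def theta_homogeneous_def Supp_eq by blast
qed

section \<open>From off-diagonal units to all units\<close>

lemma reflected_degree_one:
  assumes G: "group G" and g: "g \<in> {1..n - 1} \<rightarrow> carrier G"
    and off_diagonal: "\<And>i m j p. \<lbrakk>1 \<le> i; i < m; m \<le> n; 1 \<le> j; j < p; p \<le> n;
      elementary_degree G g i m = elementary_degree G g j p\<rbrakk> \<Longrightarrow>
      elementary_degree G g (n - m + 1) (n - i + 1) = elementary_degree G g (n - p + 1) (n - j + 1)"
    and im: "1 \<le> i" "i < m" "m \<le> n" and one: "elementary_degree G g i m = \<one>\<^bsub>G\<^esub>"
  shows "elementary_degree G g (n - m + 1) (n - i + 1) = \<one>\<^bsub>G\<^esub>"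
proof -
  interpret group G by fact
  let ?d = "elementary_degree G g"
  note closed = elementary_degree_closed[OF G g]
  note mult = elementary_degree_mult[OF G g]
  consider "m < n" | "1 < i" | "m = n" "i = 1" using im by linarith
  then show ?thesis
  proof cases
    case 1
    have "?d i n = ?d m n"
      using mult[of i m n] closed[of m n] im one by simp
    \<comment> \<open>The row \<open>n - n + 1\<close> is the first row, left in the shape of
      \<open>off_diagonal\<close>. The common left factor \<open>?d 1 (n - m + 1)\<close> is
      cancelled below.\<close>
    then have "?d (n - n + 1) (n - i + 1) = ?d (n - n + 1) (n - m + 1)"
      using im 1 by (intro off_diagonal) auto
    moreover have "?d 1 (n - i + 1) = ?d 1 (n - m + 1) \<otimes>\<^bsub>G\<^esub> ?d (n - m + 1) (n - i + 1)"
      using im by (intro mult) auto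
    ultimately show ?thesis
      using closed[of 1 "n - m + 1"] closed[of "n - m + 1" "n - i + 1"] im by simp
  next
    case 2
    have "?d 1 m = ?d 1 i"
      using mult[of 1 i m] closed[of 1 i] im one by simp
    \<comment> \<open>Here the reflections share the last column \<open>n - 1 + 1\<close>, and
      \<open>?d (n - i + 1) n\<close> is cancelled on the right.\<close>
    then have "?d (n - m + 1) (n - 1 + 1) = ?d (n - i + 1) (n - 1 + 1)"
      using im 2 by (intro off_diagonal) auto
    moreover have "?d (n - m + 1) n = ?d (n - m + 1) (n - i + 1) \<otimes>\<^bsub>G\<^esub> ?d (n - i + 1) n"
      using im by (intro mult) auto
    ultimately show ?thesis
      using closed[of "n - i + 1" n] closed[of "n - m + 1" "n - i + 1"] im 2 by simp
  next
    case 3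
    then show ?thesis using im one by simp
  qed
qed

text \<open>The pairs \<open>(i, k)\<close> parametrize the off-diagonal units E_{i,i+k}, so the
  right-hand side is the left-hand side restricted to them. What remains is to compare diagonal
  units with units of degree e, which is the task of \<open>reflected_degree_one\<close>.\<close>

lemma consec_prod_condition_iff:
  assumes G: "group G" and g: "g \<in> {1..n - 1} \<rightarrow> carrier G"
  defines "d \<equiv> case_prod (elementary_degree G g)"
  shows "(\<forall>s\<in>UT_indices n. \<forall>t\<in>UT_indices n. d s = d t \<longrightarrow> d (reflect n s) = d (reflect n t)) \<longleftrightarrow>
    (\<forall>i\<in>{1..n - 1}. \<forall>j\<in>{1..n - 1}. \<forall>k\<in>{1..n - i}. \<forall>l\<in>{1..n - j}.
      consec_prod G g i (i + k - 1) = consec_prod G g j (j + l - 1) \<longrightarrow>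
      consec_prod G g (n - i - k + 1) (n - i) = consec_prod G g (n - j - l + 1) (n - j))"
    (is "?L \<longleftrightarrow> ?R")
proof
  assume L: ?L
  show ?R
  proof (intro ballI impI)
    fix i j k l
    assume ijkl: "i \<in> {1..n - 1}" "j \<in> {1..n - 1}" "k \<in> {1..n - i}" "l \<in> {1..n - j}"
      and eq: "consec_prod G g i (i + k - 1) = consec_prod G g j (j + l - 1)"
    have "(i, i + k) \<in> UT_indices n" "(j, j + l) \<in> UT_indices n"
      using ijkl by (auto simp: UT_indices_def)
    moreover have "d (i, i + k) = d (j, j + l)"
      using eq ijkl by (simp add: d_def elementary_degree_def)
    ultimately have "d (reflect n (i, i + k)) = d (reflect n (j, j + l))" using L by blast
    \<comment> \<open>The reflected units are again off-diagonal, so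
      \<open>elementary_degree\<close> unfolds to the product and not to its diagonal value.\<close>
    moreover have "n - (i + k) < n - i" "n - (j + l) < n - j" using ijkl by auto
    ultimately show "consec_prod G g (n - i - k + 1) (n - i) = consec_prod G g (n - j - l + 1) (n - j)"
      by (simp add: d_def reflect_def elementary_degree_def)
  qed
next
  assume R: ?R
  have off_diagonal:
    "elementary_degree G g (n - m + 1) (n - i + 1) = elementary_degree G g (n - p + 1) (n - j + 1)"
    if ij: "1 \<le> i" "i < m" "m \<le> n" "1 \<le> j" "j < p" "p \<le> n"
      and eq: "elementary_degree G g i m = elementary_degree G g j p" for i m j p
  proof -
    \<comment> \<open>Condition (2) is instantiated with \<open>k = m - i\<close> and
      \<open>l = p - j\<close>.\<close>
    have "i \<in> {1..n - 1}" "j \<in> {1..n - 1}" "m - i \<in> {1..n - i}" "p - j \<in> {1..n - j}"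
      using ij by auto
    moreover have "consec_prod G g i (i + (m - i) - 1) = consec_prod G g j (j + (p - j) - 1)"
      using eq ij by (simp add: elementary_degree_def)
    ultimately have "consec_prod G g (n - i - (m - i) + 1) (n - i) =
        consec_prod G g (n - j - (p - j) + 1) (n - j)"
      using R by blast
    moreover have "n - m \<noteq> n - i" "n - p \<noteq> n - j" using ij by auto
    ultimately show ?thesis using ij by (simp add: elementary_degree_def)
  qed
  have one: "elementary_degree G g (n - m + 1) (n - i + 1) = \<one>\<^bsub>G\<^esub>"
    if "1 \<le> i" "i < m" "m \<le> n" "elementary_degree G g i m = \<one>\<^bsub>G\<^esub>" for i m
    by (rule reflected_degree_one[OF G g _ that]) (rule off_diagonal)
  show ?L
  proof (intro ballI impI)
    fix s t assume st: "s \<in> UT_indices n" "t \<in> UT_indices n" and eq: "d s = d t"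
    obtain i m j p where s: "s = (i, m)" and t: "t = (j, p)" by force
    have le: "1 \<le> i" "i \<le> m" "m \<le> n" "1 \<le> j" "j \<le> p" "p \<le> n"
      using st by (auto simp: s t UT_indices_def)
    have eq': "elementary_degree G g i m = elementary_degree G g j p"
      using eq by (simp add: s t d_def)
    have diag: "elementary_degree G g a a = \<one>\<^bsub>G\<^esub>" for a by (simp add: elementary_degree_def)
    have "elementary_degree G g (n - m + 1) (n - i + 1) = elementary_degree G g (n - p + 1) (n - j + 1)"
    proof (cases "i = m")
      case True
      \<comment> \<open>A diagonal unit and its reflection both have degree e, so E_{j,p} has degree
        e and its reflection must too.\<close>
      show ?thesis
        using one[of j p] le eq' True by (cases "j = p") (simp_all add: diag)
    next
      case im: False
      show ?thesis
      proof (cases "j = p")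
        case True
        then show ?thesis using one[of i m] le eq' im by (simp add: diag)
      next
        case False
        then show ?thesis using off_diagonal[of i m j p] le eq' im by simp
      qed
    qed
    then show "d (reflect n s) = d (reflect n t)" by (simp add: s t d_def reflect_def)
  qed
qed

theorem theorem3p6:
  fixes G :: "('g, 'm) monoid_scheme" and g :: "nat \<Rightarrow> 'g" and n :: nat
    and \<Gamma> :: "'g \<Rightarrow> 'a::field mat set"
  assumes "CHAR('a) \<noteq> 2"
    and "group G"
    and "n \<ge> 1"
    and "g \<in> {1..n - 1} \<rightarrow> carrier G"
    and "\<Gamma> = elementary_grading n G g"
  shows "homogeneous_map (UT TYPE('a) n) G \<Gamma> (canonical_involution n) \<longleftrightarrow>
    (\<forall>i\<in>{1..n - 1}. \<forall>j\<in>{1..n - 1}. \<forall>k\<in>{1..n - i}. \<forall>l\<in>{1..n - j}.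
      consec_prod G g i (i + k - 1) = consec_prod G g j (j + l - 1) \<longrightarrow>
      consec_prod G g (n - i - k + 1) (n - i) = consec_prod G g (n - j - l + 1) (n - j))"
  unfolding assms(5) homogeneous_canonical_involution_iff[OF assms(2,4)]
  by (rule consec_prod_condition_iff[OF assms(2,4)])

end
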